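(* Let $s\ge 2$, $n\ge s+1$ and $t\ge -1$ be integers. Let $G$ be a connected graph with $n$ vertices and $n+t$ edges which contains no suspended path with more than $s$ vertices, and let $p$ be the total number of vertices of $G$ that are adjacent to at least one leaf of $G$. Then $G$ has at least $$\min\{\,n-1,\; n-(s-1)(2p+3t)-1\,\}$$ leaves. In particular, $G$ has at least $\frac{n-3(s-1)t-1}{2s-1}$ leaves.
   Context: All graphs are finite and simple. A leaf is a vertex of degree $1$. A suspended path in $G$ is a path in $G$ all of whose internal vertices have degree $2$ in $G$. *)

theory Defs
  imports Complex_Main "Graph_Theory.Digraph_Component" "Graph_Theory.Vertex_Walk"
begin

text \<open>
  A finite simple graph is a member of the locale \<^locale>\<open>graph\<close>: a finite, loop-free, symmetric
  digraph without parallel arcs. Each undirected edge is thus a pair of opposite arcs, so the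
  number of edges is the number of two-element sets below (not the number of arcs), while the
  degree of a vertex is its \<^const>\<open>out_degree\<close>.
\<close>

definition uedges :: "('a, 'b) pre_digraph \<Rightarrow> 'a set set" where
  "uedges G = {{u, v} | u v. u \<rightarrow>\<^bsub>G\<^esub> v}"

definition leaves :: "('a, 'b) pre_digraph \<Rightarrow> 'a set" where
  "leaves G = {v \<in> verts G. out_degree G v = 1}"

definition leaf_neighbours :: "('a, 'b) pre_digraph \<Rightarrow> 'a set" where
  "leaf_neighbours G = {v \<in> verts G. \<exists>l \<in> leaves G. v \<rightarrow>\<^bsub>G\<^esub> l}"

text \<open>
  A path is given by its list of (distinct) vertices; \<open>butlast (tl P)\<close> lists the internal ones.
\<close>

definition suspended_path :: "('a, 'b) pre_digraph \<Rightarrow> 'a list \<Rightarrow> bool" where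
  "suspended_path G P \<longleftrightarrow> vpath P G \<and> (\<forall>v \<in> set (butlast (tl P)). out_degree G v = 2)"

end

theory Submission
  imports Defs
begin

text \<open>
  Delete all leaves; the remaining graph \<open>G'\<close> is connected and still has \<open>t\<close> more edges than
  vertices. Let \<open>S\<close> consist of the former neighbours of leaves and the vertices of degree other than
  two in \<open>G'\<close>. The vertices outside \<open>S\<close> form ears: paths both of whose ends are attached to \<open>S\<close>.
  Counting arcs from \<open>S\<close> shows that there are at most \<open>|S| + t\<close> ears, and that
  \<open>|S| \<le> 2p + 2t\<close>, as a vertex of \<open>S\<close> not adjacent to a leaf has degree at least three. An ear has
  at most \<open>s - 2\<close> vertices, or \<open>s - 1\<close> if it is closed, that is, attached to the same vertex at
  both ends. Closed ears are edge-disjoint cycles that can be opened without disconnecting \<open>G'\<close>, so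
  there are at most \<open>t + 1\<close> of them. Altogether \<open>G'\<close> has at most \<open>(s - 1)(2p + 3t) + 1\<close> vertices.
\<close>

section \<open>Connected symmetric relations\<close>

text \<open>Every edge is a pair of opposite arcs, hence the factor two.\<close>

lemma connected_card_ge:
  fixes E :: "('a \<times> 'a) set"
  assumes "finite V" "finite E" "sym E" "r \<in> V" and reach: "\<And>v. v \<in> V \<Longrightarrow> (r, v) \<in> E\<^sup>*"
    and sub: "E \<subseteq> V \<times> V"
  shows "2 * card V \<le> card E + 2"
proof -
  \<comment> \<open>Grow a set from \<open>r\<close> one vertex at a time. Each new vertex brings at
    least two arcs, one in each direction; the single vertex \<open>r\<close> accounts for the
    constant 2.\<close>
  have "\<exists>W\<subseteq>V. r \<in> W \<and> card W = k \<and> 2 * k \<le> card (E \<inter> W \<times> W) + 2"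
    if "1 \<le> k" "k \<le> card V" for k
    using that
  proof (induction k rule: dec_induct)
    case base
    then show ?case using \<open>r \<in> V\<close> by (intro exI[of _ "{r}"]) auto
  next
    case (step k)
    then obtain W where W: "W \<subseteq> V" "r \<in> W" "card W = k" "2 * k \<le> card (E \<inter> W \<times> W) + 2"
      by auto
    \<comment> \<open>If no arc left \<open>W\<close>, everything reachable from \<open>r\<close>,
      hence all of \<open>V\<close>, would lie in \<open>W\<close>, which has fewer
      vertices.\<close>
    have "\<exists>u v. (u, v) \<in> E \<and> u \<in> W \<and> v \<notin> W"
    proof (rule ccontr)
      assume neg: "\<not> ?thesis"
      have "v \<in> W" if "(r, v) \<in> E\<^sup>*" for v
        using that by induction (use W neg in auto)
      then have "V \<subseteq> W" using reach by auto
      with W step show False by auto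
    qed
    then obtain u v where uv: "(u, v) \<in> E" "u \<in> W" "v \<notin> W" by blast
    then have vu: "(v, u) \<in> E" "u \<noteq> v" using \<open>sym E\<close> symD by fastforce+
    have "card (E \<inter> W \<times> W \<union> {(u, v), (v, u)}) = card (E \<inter> W \<times> W) + card {(u, v), (v, u)}"
      using uv \<open>finite E\<close> by (intro card_Un_disjoint) auto
    moreover have "card {(u, v), (v, u)} = 2" using vu by simp
    moreover have "card (E \<inter> W \<times> W \<union> {(u, v), (v, u)}) \<le> card (E \<inter> insert v W \<times> insert v W)"
      using uv vu \<open>finite E\<close> by (intro card_mono) auto
    moreover have "card (insert v W) = Suc k"
      using W uv finite_subset[OF W(1) \<open>finite V\<close>] by auto
    ultimately show ?case
      using W uv sub by (intro exI[of _ "insert v W"]) auto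
  qed
  from this[of "card V"] obtain W where "W \<subseteq> V" "card W = card V"
      "2 * card V \<le> card (E \<inter> W \<times> W) + 2"
    using \<open>r \<in> V\<close> \<open>finite V\<close> by (auto simp: Suc_le_eq card_gt_0_iff)
  moreover have "card (E \<inter> W \<times> W) \<le> card E"
    using \<open>finite E\<close> by (intro card_mono) auto
  ultimately show ?thesis by linarith
qed

lemma successively_hd_rtrancl:
  "successively (\<lambda>u v. (u, v) \<in> R) xs \<Longrightarrow> y \<in> set xs \<Longrightarrow> (hd xs, y) \<in> R\<^sup>*"
  by (induction xs rule: induct_list012) (auto intro: converse_rtrancl_into_rtrancl)

section \<open>Double counting of arcs\<close>

lemma card_Int_Times_eq_sum:
  assumes "finite T" "finite V" "E \<subseteq> V \<times> V"
  shows "card (E \<inter> T \<times> V) = (\<Sum>v\<in>T. card (E `` {v}))"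
proof -
  have "E \<inter> T \<times> V = Sigma T (\<lambda>v. E `` {v})" using assms(3) by auto
  moreover have "finite (E `` {v})" for v
    using assms by (auto intro!: finite_subset[of "E `` {v}" V])
  ultimately show ?thesis using assms by simp
qed

lemma card_sym_irrefl:
  assumes "finite R" "sym R" "irrefl R"
  shows "card R = 2 * card ((\<lambda>(u, v). {u, v}) ` R)"
proof -
  let ?g = "\<lambda>(u, v). {u, v}"
  have "card R = (\<Sum>e\<in>?g ` R. card {x \<in> R. ?g x = e})"
    using sum.image_gen[OF \<open>finite R\<close>, of "\<lambda>_. 1::nat" ?g] by simp
  also have "\<dots> = (\<Sum>e\<in>?g ` R. 2)"
  proof (rule sum.cong)
    fix e assume "e \<in> ?g ` R"
    then obtain u v where uv: "(u, v) \<in> R" "e = {u, v}" by auto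
    have vu: "(v, u) \<in> R" using \<open>sym R\<close> uv(1) by (rule symD)
    have "x \<in> R \<and> ?g x = e \<longleftrightarrow> x \<in> {(u, v), (v, u)}" for x
      using uv vu by (cases x) (auto simp: doubleton_eq_iff)
    then have "{x \<in> R. ?g x = e} = {(u, v), (v, u)}" by (simp only: Collect_mem_eq)
    moreover have "u \<noteq> v" using \<open>irrefl R\<close> uv(1) by (auto simp: irrefl_def)
    ultimately show "card {x \<in> R. ?g x = e} = 2" by simp
  qed simp
  finally show ?thesis by simp
qed

section \<open>Decomposition into ears\<close>

text \<open>\<open>S\<close> may contain vertices of degree two as well. This covers former leaf
  neighbours and allows a cycle to be cut at an arbitrary vertex.\<close>

locale branched_graph =
  fixes V :: "'a set" and E :: "('a \<times> 'a) set" and S :: "'a set"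
  assumes finite_V: "finite V" and E_sub: "E \<subseteq> V \<times> V"
    and sym_E: "sym E" and irrefl_E: "irrefl E"
    and conn: "u \<in> V \<Longrightarrow> v \<in> V \<Longrightarrow> (u, v) \<in> E\<^sup>*"
    and S_sub: "S \<subseteq> V" and S_nonempty: "S \<noteq> {}"
    and degree_two: "v \<in> V - S \<Longrightarrow> card (E `` {v}) = 2"
begin

section \<open>Components outside \<open>S\<close>\<close>

definition inner :: "('a \<times> 'a) set" where
  "inner = E \<inter> (V - S) \<times> (V - S)"

definition comp :: "'a \<Rightarrow> 'a set" where
  "comp x = inner\<^sup>* `` {x}"

lemma finite_E: "finite E"
  using finite_V E_sub finite_subset by blast

lemma E_symD: "(u, v) \<in> E \<Longrightarrow> (v, u) \<in> E"
  using sym_E by (auto dest: symD)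

lemma E_neq: "(u, v) \<in> E \<Longrightarrow> u \<noteq> v"
  using irrefl_E by (auto simp: irrefl_def)

lemma sym_inner: "sym inner"
  using sym_E by (auto simp: inner_def sym_def)

lemma comp_subset: "x \<in> V - S \<Longrightarrow> comp x \<subseteq> V - S"
proof
  fix y assume "x \<in> V - S" "y \<in> comp x"
  then have "(x, y) \<in> inner\<^sup>*" by (simp add: comp_def)
  then show "y \<in> V - S" using \<open>x \<in> V - S\<close> by induction (auto simp: inner_def)
qed

lemma comp_eq: "y \<in> comp x \<Longrightarrow> comp y = comp x"
  using sym_rtrancl[OF sym_inner] unfolding comp_def
  by (auto dest: symD intro: rtrancl_trans)

lemma self_in_comp: "x \<in> comp x"
  by (simp add: comp_def)

section \<open>Tracing each component as an ear\<close>

lemma nbrs_eq: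
  assumes "z \<in> V - S" "(u, z) \<in> E" "(z, w) \<in> E" "u \<noteq> w"
  shows "E `` {z} = {u, w}"
proof (rule sym, rule card_subset_eq)
  \<comment> \<open>An infinite set would have cardinality 0, not 2.\<close>
  show "finite (E `` {z})" using degree_two[OF assms(1)] card.infinite by fastforce
  show "{u, w} \<subseteq> E `` {z}" using assms E_symD by auto
  show "card {u, w} = card (E `` {z})" using degree_two[OF assms(1)] assms(4) by simp
qed

text \<open>Trace a walk from \<open>S\<close> to \<open>x\<close> backwards: without an arc from
  \<open>S\<close> into the component it would never leave the component, so it could not start in
  \<open>S\<close>.\<close>

lemma ex_arc_into_comp:
  assumes "x \<in> V - S"
  shows "\<exists>a c. a \<in> S \<and> c \<in> comp x \<and> (a, c) \<in> E"
proof (rule ccontr)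
  assume neg: "\<not> ?thesis"
  obtain r where "r \<in> S" using S_nonempty by auto
  with assms S_sub have "(r, x) \<in> E\<^sup>*" by (intro conn) auto
  then have "r \<in> comp x"
  proof (induction rule: converse_rtrancl_induct)
    case base
    show ?case by (rule self_in_comp)
  next
    case (step y z)
    then have "(y, z) \<in> inner"
      using neg comp_subset[OF assms] E_sub by (auto simp: inner_def)
    then have "(z, y) \<in> inner" using sym_inner by (auto dest: symD)
    then show ?case using step.IH by (auto simp: comp_def)
  qed
  then show False using comp_subset[OF assms] \<open>r \<in> S\<close> by auto
qed

text \<open>Closed ears, with \<open>a = b\<close>, are allowed. The last clause rules out a single
  vertex visited by going back and forth along one edge.\<close>

definition ear :: "'a \<Rightarrow> 'a list \<Rightarrow> 'a \<Rightarrow> bool" where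
  "ear a xs b \<longleftrightarrow> a \<in> S \<and> b \<in> S \<and> xs \<noteq> [] \<and> distinct xs \<and> set xs \<subseteq> V - S
    \<and> successively (\<lambda>u v. (u, v) \<in> E) (a # xs @ [b]) \<and> (length xs = 1 \<longrightarrow> a \<noteq> b)"

text \<open>A longest path that starts in \<open>S\<close> and then stays outside \<open>S\<close> can only be left, at its last
  vertex, towards \<open>S\<close>; as its vertices have degree two, it exhausts the component.\<close>

lemma ex_ear:
  assumes x: "x \<in> V - S"
  shows "\<exists>a xs b. ear a xs b \<and> set xs = comp x"
proof -
  let ?R = "\<lambda>u v. (u, v) \<in> E"
  obtain a c where ac: "a \<in> S" "c \<in> comp x" "(a, c) \<in> E"
    using ex_arc_into_comp[OF x] by auto
  define P where "P xs \<longleftrightarrow> xs \<noteq> [] \<and> hd xs = c \<and> distinct xs \<and> successively ?R (a # xs)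
    \<and> set xs \<subseteq> V - S" for xs
  have "P [c]" using ac comp_subset[OF x] by (auto simp: P_def)
  moreover have "\<forall>xs. P xs \<longrightarrow> length xs < Suc (card V)"
  proof (intro allI impI)
    fix xs assume "P xs"
    then have "length xs = card (set xs)" by (simp add: P_def distinct_card)
    also have "\<dots> \<le> card V" using \<open>P xs\<close> finite_V by (intro card_mono) (auto simp: P_def)
    finally show "length xs < Suc (card V)" by simp
  qed
  ultimately obtain xs where xs: "P xs" and max: "\<And>ys. P ys \<Longrightarrow> length ys \<le> length xs"
    using ex_has_greatest_nat[of P "[c]" length] by blast
  obtain bs l where bs: "xs = bs @ [l]" using xs by (auto simp: P_def intro: rev_exhaust)
  \<comment> \<open>The predecessor of \<open>l\<close> on the path, which is \<open>a\<close> when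
    \<open>l\<close> is the only vertex of \<open>xs\<close>.\<close>
  define p0 where "p0 = last (a # bs)"
  have a_notin: "a \<notin> set xs" using xs ac by (auto simp: P_def)
  have l: "l \<in> V - S" using xs bs by (auto simp: P_def)
  have succ: "successively ?R ((a # bs) @ [l])" using xs bs by (simp add: P_def)
  then have p0: "(p0, l) \<in> E" unfolding successively_append_iff p0_def by simp
  obtain b where b: "(l, b) \<in> E" "b \<noteq> p0" "E `` {l} = {p0, b}"
  proof -
    obtain y z where yz: "E `` {l} = {y, z}" "y \<noteq> z" using degree_two[OF l] card_2_iff by metis
    moreover have "p0 \<in> E `` {l}" using p0 E_symD by auto
    ultimately have "p0 = y \<or> p0 = z" by blast
    moreover have "(l, y) \<in> E" "(l, z) \<in> E" using yz(1) by blast+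
    ultimately show ?thesis using yz that[of y] that[of z] by (metis insert_commute)
  qed
  \<comment> \<open>A vertex before \<open>l\<close> has degree two, so its predecessor and
    successor on the path are its only neighbours.\<close>
  have interior: "\<exists>u w. E `` {z} = {u, w} \<and> u \<in> insert a (set us) \<and> w = hd (vs @ [l])"
    if z: "bs = us @ z # vs" for z us vs
  proof -
    have "successively ?R ((a # us) @ z # (vs @ [l]))" using succ z by simp
    then have "(last (a # us), z) \<in> E" "(z, hd (vs @ [l])) \<in> E"
      unfolding successively_append_iff successively_Cons by auto
    moreover have "z \<in> V - S" using xs bs z by (auto simp: P_def)
    moreover have last_us: "last (a # us) \<in> insert a (set us)"
      using last_in_set[of "a # us"] by simp
    moreover have "last (a # us) \<noteq> hd (vs @ [l])"
    proof -
      have "hd (vs @ [l]) \<in> set (vs @ [l])" by (intro hd_in_set) simp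
      moreover have "insert a (set us) \<inter> set (vs @ [l]) = {}"
        using xs bs z a_notin by (auto simp: P_def)
      ultimately show ?thesis using last_us by auto
    qed
    ultimately show ?thesis using nbrs_eq by blast
  qed
  \<comment> \<open>Were \<open>b\<close> on the path before \<open>l\<close>, then \<open>l\<close>
    would be its successor and \<open>b\<close> would equal \<open>p0\<close>.\<close>
  have "b \<notin> set bs"
  proof
    assume "b \<in> set bs"
    then obtain us vs where z: "bs = us @ b # vs" by (auto simp: in_set_conv_decomp)
    from interior[OF z] obtain u w where uw: "E `` {b} = {u, w}" "u \<in> insert a (set us)"
      "w = hd (vs @ [l])" by auto
    have "l \<in> {u, w}" using b(1) E_symD uw(1) by auto
    moreover have "l \<noteq> u" using uw(2) xs bs z a_notin by (auto simp: P_def)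
    ultimately have "l = hd (vs @ [l])" using uw by auto
    moreover have "l \<notin> set vs" using xs bs z by (auto simp: P_def)
    ultimately have "vs = []" by (cases vs) auto
    then show False using z b(2) by (simp add: p0_def)
  qed
  then have b_notin: "b \<notin> set xs" using E_neq[OF b(1)] bs by auto
  have "b \<in> S"
  proof (rule ccontr)
    \<comment> \<open>Otherwise \<open>b\<close> would extend the longest path.\<close>
    assume "b \<notin> S"
    moreover have "xs \<noteq> []" "last xs = l" using bs by auto
    ultimately have "P (xs @ [b])" using xs b(1) b_notin E_sub
      by (auto simp: P_def successively_append_iff successively_Cons)
    then show False using max by fastforce
  qed
  have closed: "y \<in> set xs" if z: "z \<in> set xs" "(z, y) \<in> inner" for z y
  proof (cases "z = l")
    case True
    then have "y = p0" "y \<noteq> a" using that b \<open>b \<in> S\<close> ac by (auto simp: inner_def)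
    then show ?thesis by (auto simp: p0_def bs split: if_splits)
  next
    case False
    then obtain us vs where "bs = us @ z # vs" using z bs by (auto simp: in_set_conv_decomp)
    with interior[OF this] obtain u where "E `` {z} = {u, hd (vs @ [l])}" "u \<in> insert a (set us)"
      by auto
    moreover have "y \<in> E `` {z}" using z by (auto simp: inner_def)
    ultimately have "y \<in> insert a (set us) \<union> {hd (vs @ [l])}" by auto
    moreover have "hd (vs @ [l]) \<in> set (vs @ [l])" by (intro hd_in_set) simp
    moreover have "y \<noteq> a" using z ac by (auto simp: inner_def)
    ultimately show ?thesis using bs \<open>bs = us @ z # vs\<close> by auto
  qed
  have "comp c = set xs"
  proof
    show "comp c \<subseteq> set xs"
    proof
      fix y assume "y \<in> comp c"
      then have "(c, y) \<in> inner\<^sup>*" by (simp add: comp_def)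
      then show "y \<in> set xs"
      proof induction
        case base
        then show ?case using xs hd_in_set by (auto simp: P_def)
      qed (rule closed)
    qed
    have "successively ?R xs" using xs by (auto simp: P_def successively_Cons)
    then have "successively (\<lambda>u v. (u, v) \<in> inner) xs"
      by (rule successively_mono) (use xs in \<open>auto simp: P_def inner_def\<close>)
    then show "set xs \<subseteq> comp c"
      using successively_hd_rtrancl xs by (fastforce simp: P_def comp_def)
  qed
  then have "set xs = comp x" using comp_eq ac by auto
  moreover have "successively ?R (a # xs @ [b])"
  proof -
    have "last xs = l" "xs \<noteq> []" using bs by auto
    then show ?thesis
      using xs b(1) by (auto simp: P_def successively_append_iff successively_Cons)
  qed
  moreover have "length xs = 1 \<longrightarrow> a \<noteq> b" using b bs by (auto simp: p0_def)
  ultimately have "ear a xs b \<and> set xs = comp x"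
    using xs ac \<open>b \<in> S\<close> unfolding ear_def P_def by blast
  then show ?thesis by blast
qed

section \<open>Counting ears and closed ears\<close>

definition comps :: "'a set set" where
  "comps = comp ` (V - S)"

lemma finite_comps: "finite comps"
  using finite_V by (simp add: comps_def)

lemma comps_disjoint: "C \<in> comps \<Longrightarrow> D \<in> comps \<Longrightarrow> y \<in> C \<Longrightarrow> y \<in> D \<Longrightarrow> C = D"
  unfolding comps_def using comp_eq by blast

lemma Union_comps: "\<Union>comps = V - S"
  using comp_subset self_in_comp unfolding comps_def by blast

lemma card_inner_vertices: "card (V - S) = (\<Sum>C\<in>comps. card C)"
proof -
  have "card (\<Union>comps) = sum card comps"
  proof (rule card_Union_disjoint)
    show "pairwise disjnt comps"
      unfolding pairwise_def disjnt_def using comps_disjoint by blast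
    show "finite C" if "C \<in> comps" for C
      using that Union_comps finite_V by (metis Union_upper finite_Diff finite_subset)
  qed
  then show ?thesis by (simp add: Union_comps)
qed

lemma ex_ears:
  obtains a X b where "\<And>C. C \<in> comps \<Longrightarrow> ear (a C) (X C) (b C) \<and> set (X C) = C"
proof -
  have "\<forall>C. \<exists>q. C \<in> comps \<longrightarrow> ear (fst q) (fst (snd q)) (snd (snd q)) \<and> set (fst (snd q)) = C"
    using ex_ear by (fastforce simp: comps_def)
  then obtain q where "\<forall>C. C \<in> comps \<longrightarrow>
      ear (fst (q C)) (fst (snd (q C))) (snd (snd (q C))) \<and> set (fst (snd (q C))) = C"
    by metis
  then show thesis by (intro that) blast
qed

text \<open>Both end arcs, directed away from \<open>S\<close>, are distinct even for a closed ear: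
  if they coincided, distinctness would leave a single vertex attached twice to the same
  end.\<close>

lemma ear_ends:
  assumes "ear a xs b"
  shows "(a, hd xs) \<in> E" "(last xs, b) \<in> E" "(a, hd xs) \<noteq> (b, last xs)"
    "hd xs \<in> set xs" "last xs \<in> set xs"
proof -
  from assms have ne: "xs \<noteq> []" and dist: "distinct xs" and one: "length xs = 1 \<longrightarrow> a \<noteq> b"
    by (auto simp: ear_def)
  from assms show "(a, hd xs) \<in> E" "(last xs, b) \<in> E" "hd xs \<in> set xs" "last xs \<in> set xs"
    by (auto simp: ear_def successively_Cons successively_append_iff)
  show "(a, hd xs) \<noteq> (b, last xs)"
  proof
    assume eq: "(a, hd xs) = (b, last xs)"
    then have "length xs = 1" using ne dist by (cases xs) (auto split: if_splits)
    with one eq show False by auto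
  qed
qed

text \<open>Two arcs lead from \<open>S\<close> into each component, and their heads tell the
  components apart. Each vertex outside \<open>S\<close> is the tail of two further arcs.\<close>

lemma card_comps_le:
  "2 * card comps + 2 * card (V - S) \<le> card E"
proof -
  obtain a X b where X: "\<And>C. C \<in> comps \<Longrightarrow> ear (a C) (X C) (b C) \<and> set (X C) = C"
    using ex_ears by blast
  define A where "A C = {(a C, hd (X C)), (b C, last (X C))}" for C
  have snd_A: "snd ` A C \<subseteq> C" if "C \<in> comps" for C
    using X[OF that] ear_ends(4,5)[of "a C" "X C" "b C"] by (auto simp: A_def)
  have "card (\<Union>C\<in>comps. A C) = (\<Sum>C\<in>comps. card (A C))"
  proof (rule card_UN_disjoint)
    show "\<forall>C\<in>comps. \<forall>D\<in>comps. C \<noteq> D \<longrightarrow> A C \<inter> A D = {}"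
    proof (intro ballI impI)
      fix C D assume CD: "C \<in> comps" "D \<in> comps" "C \<noteq> D"
      then have "C \<inter> D = {}" using comps_disjoint by blast
      then show "A C \<inter> A D = {}" using snd_A[OF CD(1)] snd_A[OF CD(2)] by blast
    qed
  qed (auto simp: finite_comps A_def)
  also have "\<dots> = (\<Sum>C\<in>comps. 2)"
  proof (rule sum.cong)
    fix C assume "C \<in> comps"
    then show "card (A C) = 2" using X ear_ends(3)[of "a C" "X C" "b C"] by (simp add: A_def)
  qed simp
  finally have "card (\<Union>C\<in>comps. A C) = 2 * card comps" by simp
  moreover have "(\<Union>C\<in>comps. A C) \<subseteq> E \<inter> S \<times> V"
  proof (rule UN_least)
    fix C assume "C \<in> comps"
    with X have e: "ear (a C) (X C) (b C)" by auto
    show "A C \<subseteq> E \<inter> S \<times> V"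
      using ear_ends(1,2)[OF e] e E_symD E_sub by (auto simp: A_def ear_def)
  qed
  then have "card (\<Union>C\<in>comps. A C) \<le> card (E \<inter> S \<times> V)"
    using finite_E by (intro card_mono) auto
  moreover have "card (E \<inter> (V - S) \<times> V) = 2 * card (V - S)"
    using card_Int_Times_eq_sum[of "V - S" V E] finite_V E_sub degree_two by simp
  moreover have "card (E \<inter> S \<times> V \<union> E \<inter> (V - S) \<times> V)
      = card (E \<inter> S \<times> V) + card (E \<inter> (V - S) \<times> V)"
    using finite_E by (intro card_Un_disjoint) auto
  moreover have "E \<inter> S \<times> V \<union> E \<inter> (V - S) \<times> V = E"
    using E_sub by auto
  ultimately show ?thesis by simp
qed

text \<open>Deleting the first edge of each closed ear keeps the graph connected, as the rest of the ear
  still joins the two ends of that edge.\<close>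

lemma card_closed_ears_le:
  assumes X: "\<And>C. C \<in> comps \<Longrightarrow> ear (a C) (X C) (b C) \<and> set (X C) = C"
  shows "2 * card {C \<in> comps. a C = b C} + 2 * card V \<le> card E + 2"
proof -
  define L where "L = {C \<in> comps. a C = b C}"
  define f where "f C = (a C, hd (X C))" for C
  define R where "R = f ` L"
  define E' where "E' = E - R - R\<inverse>"
  have L: "ear (a C) (X C) (a C)" "set (X C) = C" "C \<in> comps" if "C \<in> L" for C
    using X[of C] that by (auto simp: L_def)
  have R_sub: "R \<subseteq> E \<inter> S \<times> (V - S)"
  proof
    fix e assume "e \<in> R"
    then obtain C where "C \<in> L" "e = f C" by (auto simp: R_def)
    with L[of C] ear_ends[of "a C" "X C" "a C"] show "e \<in> E \<inter> S \<times> (V - S)"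
      by (auto simp: f_def ear_def)
  qed
  have "inj_on f L"
  proof (rule inj_onI)
    fix C D assume CD: "C \<in> L" "D \<in> L" "f C = f D"
    have "hd (X C) \<in> C" "hd (X D) \<in> D"
      using L[OF CD(1)] L[OF CD(2)] ear_ends(4) by metis+
    then show "C = D" using CD L comps_disjoint by (auto simp: f_def)
  qed
  then have card_R: "card R = card L" by (simp add: R_def card_image)
  have fin_R: "finite R" using R_sub finite_E finite_subset by blast
  \<comment> \<open>Arcs of \<open>R\<close> lead out of \<open>S\<close> and their reverses lead
    into it, so the two sets are disjoint.\<close>
  have "card (R \<union> R\<inverse>) = card R + card (R\<inverse>)"
    using R_sub fin_R by (intro card_Un_disjoint) auto
  then have "card (R \<union> R\<inverse>) = 2 * card L" by (simp add: card_R)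
  moreover have "R \<union> R\<inverse> \<subseteq> E" using R_sub E_symD by auto
  moreover have "E' = E - (R \<union> R\<inverse>)" by (auto simp: E'_def)
  ultimately have card_E': "card E' + 2 * card L = card E"
    using finite_E card_mono[of E "R \<union> R\<inverse>"] by (simp add: card_Diff_subset fin_R)
  have sym_E': "sym E'" using sym_E by (auto simp: E'_def sym_def)
  have detour: "(hd (X C), a C) \<in> E'\<^sup>*" if "C \<in> L" for C
  proof -
    from L[OF that] have e: "ear (a C) (X C) (a C)" and C: "set (X C) = C" "C \<in> comps" by auto
    \<comment> \<open>The head of a deleted arc determines its component, so the only arc of
      \<open>R\<close> into \<open>C\<close> is the first arc of its own ear.\<close>
    have no_R: "y = hd (X C) \<and> z = a C" if "(z, y) \<in> R" "y \<in> C" for z y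
    proof -
      from that obtain D where D: "D \<in> L" "(z, y) = f D" by (auto simp: R_def)
      then have "y \<in> D" using L[OF D(1)] ear_ends(4) by (metis f_def snd_conv)
      then have "C = D" using C L[OF D(1)] comps_disjoint \<open>y \<in> C\<close> by blast
      then show ?thesis using D by (simp add: f_def)
    qed
    have "successively (\<lambda>u v. (u, v) \<in> E) (X C)"
      using e by (auto simp: ear_def successively_Cons successively_append_iff)
    then have "successively (\<lambda>u v. (u, v) \<in> E') (X C)"
    proof (rule successively_mono)
      fix u v assume "u \<in> set (X C)" "v \<in> set (X C)" "(u, v) \<in> E"
      then show "(u, v) \<in> E'" using e R_sub by (auto simp: E'_def ear_def)
    qed
    then have "(hd (X C), last (X C)) \<in> E'\<^sup>*"
      using successively_hd_rtrancl ear_ends(5)[OF e] by metis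
    moreover have "(last (X C), a C) \<in> E'"
    proof -
      \<comment> \<open>A closed ear has at least two vertices, so its last edge differs from the
        deleted first edge.\<close>
      have "last (X C) \<noteq> hd (X C)" using ear_ends(3)[OF e] by auto
      moreover have "last (X C) \<in> C" using ear_ends(5)[OF e] C by auto
      ultimately show ?thesis
        using ear_ends(2)[OF e] no_R[of "a C" "last (X C)"] R_sub e by (auto simp: E'_def ear_def)
    qed
    ultimately show ?thesis by (rule rtrancl_into_rtrancl)
  qed
  have "E \<subseteq> E'\<^sup>*"
  proof
    fix e assume "e \<in> E"
    show "e \<in> E'\<^sup>*"
    proof (cases "e \<in> R \<union> R\<inverse>")
      case False
      then have "e \<in> E'" using \<open>e \<in> E\<close> by (auto simp: E'_def)
      then show ?thesis by auto
    next
      case True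
      then obtain C where "C \<in> L" "e = (hd (X C), a C) \<or> e = (a C, hd (X C))"
        by (auto simp: R_def f_def)
      then show ?thesis
        using detour[of C] sym_rtrancl[OF sym_E'] by (auto dest: symD)
    qed
  qed
  then have reach: "E\<^sup>* \<subseteq> E'\<^sup>*" by (rule rtrancl_subset_rtrancl)
  obtain r where r: "r \<in> V" using S_nonempty S_sub by auto
  have "2 * card V \<le> card E' + 2"
  proof (rule connected_card_ge[OF finite_V _ sym_E' r])
    show "finite E'" "E' \<subseteq> V \<times> V" using finite_E E_sub by (auto simp: E'_def)
    show "(r, v) \<in> E'\<^sup>*" if "v \<in> V" for v using conn[OF r that] reach by auto
  qed
  then show ?thesis using card_E' by (simp add: L_def)
qed

text \<open>With at most |S| + t ears and t + 1 closed ones, |V| is at most |S| + (s-2)(|S|+t) +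
  (t+1), which is the stated bound.\<close>

lemma card_vertices_le:
  fixes s t :: int
  assumes "s \<ge> 2" and card_E: "int (card E) = 2 * (int (card V) + t)"
    and short: "\<And>P. P \<noteq> [] \<Longrightarrow> distinct P \<Longrightarrow> set P \<subseteq> V
      \<Longrightarrow> successively (\<lambda>u v. (u, v) \<in> E) P \<Longrightarrow> set (butlast (tl P)) \<inter> S = {}
      \<Longrightarrow> int (length P) \<le> s"
  shows "int (card V) \<le> (s - 1) * (int (card S) + t) + 1"
proof -
  obtain a X b where X: "\<And>C. C \<in> comps \<Longrightarrow> ear (a C) (X C) (b C) \<and> set (X C) = C"
    using ex_ears by blast
  define L where "L = {C \<in> comps. a C = b C}"
  have card_C: "int (card C) \<le> (s - 2) + (if a C = b C then 1 else 0)" if "C \<in> comps" for C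
  proof -
    from X[OF that] have e: "ear (a C) (X C) (b C)" and C: "set (X C) = C" by auto
    from e have len: "card C = length (X C)" using C by (metis distinct_card ear_def)
    show ?thesis
    proof (cases "a C = b C")
      case True
      \<comment> \<open>Appending \<open>b C = a C\<close> would repeat a vertex, so only one end is
        added; this is why a closed ear may have one vertex more.\<close>
      have "int (length (a C # X C)) \<le> s"
      proof (rule short)
        show "set (butlast (tl (a C # X C))) \<inter> S = {}"
          using e by (auto simp: ear_def dest: in_set_butlastD)
      qed (use e S_sub in \<open>auto simp: ear_def successively_Cons successively_append_iff\<close>)
      with True len show ?thesis by simp
    next
      case False
      have "int (length (a C # X C @ [b C])) \<le> s"
        by (rule short) (use e S_sub False in \<open>auto simp: ear_def\<close>)
      with False len show ?thesis by simp
    qed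
  qed
  have "int (card (V - S)) = (\<Sum>C\<in>comps. int (card C))"
    by (simp add: card_inner_vertices)
  also have "\<dots> \<le> (\<Sum>C\<in>comps. (s - 2) + (if a C = b C then 1 else 0))"
    by (intro sum_mono card_C)
  also have "\<dots> = (s - 2) * int (card comps) + int (card L)"
    using finite_comps by (simp add: sum.distrib L_def flip: sum.inter_filter)
  finally have inner: "int (card (V - S)) \<le> (s - 2) * int (card comps) + int (card L)" .
  have cardV: "int (card V) = int (card S) + int (card (V - S))"
    using finite_V S_sub by (simp add: card_Diff_subset finite_subset card_mono)
  have arcs: "int (card E) = 2 * int (card V) + 2 * t" using card_E by simp
  have "int (card comps) \<le> int (card S) + t"
    using card_comps_le arcs cardV by linarith
  then have "(s - 2) * int (card comps) \<le> (s - 2) * (int (card S) + t)"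
    using \<open>s \<ge> 2\<close> by (intro mult_left_mono) auto
  moreover have "int (card L) \<le> t + 1"
    using card_closed_ears_le[OF X] arcs unfolding L_def by linarith
  ultimately have "int (card V) \<le> (s - 2) * (int (card S) + t) + (t + 1) + int (card S)"
    using inner cardV by linarith
  then show ?thesis by (simp add: algebra_simps)
qed

end

section \<open>The graph without its leaves\<close>

lemma vwalk_arcs_subset_iff:
  "set (vwalk_arcs P) \<subseteq> E \<longleftrightarrow> successively (\<lambda>u v. (u, v) \<in> E) P"
  by (induction P rule: vwalk_arcs.induct) auto

text \<open>Meant for the graph left after deleting leaves, with \<open>A\<close> the former leaf
  neighbours. Their degrees have dropped, so \<open>A\<close> is kept out of path interiors in
  \<open>short\<close> and exempted in \<open>leaf\<close>.\<close>

lemma marked_graph_card_le: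
  fixes V :: "'a set" and s t :: int
  assumes fin: "finite V" and sub: "E \<subseteq> V \<times> V" and "sym E" and "irrefl E"
    and conn: "\<And>u v. u \<in> V \<Longrightarrow> v \<in> V \<Longrightarrow> (u, v) \<in> E\<^sup>*"
    and "card V \<ge> 2" and "A \<subseteq> V"
    and leaf: "\<And>v. v \<in> V - A \<Longrightarrow> card (E `` {v}) \<noteq> 1"
    and unmarked: "A = {} \<Longrightarrow> int (card V) > s"
    and "s \<ge> 2" and card_E: "int (card E) = 2 * (int (card V) + t)"
    and short: "\<And>P. P \<noteq> [] \<Longrightarrow> distinct P \<Longrightarrow> set P \<subseteq> V
      \<Longrightarrow> successively (\<lambda>u v. (u, v) \<in> E) P
      \<Longrightarrow> (\<forall>v\<in>set (butlast (tl P)). v \<notin> A \<and> card (E `` {v}) = 2)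
      \<Longrightarrow> int (length P) \<le> s"
  shows "int (card V) \<le> (s - 1) * (2 * int (card A) + 3 * t) + 1"
proof -
  define S where "S = {v \<in> V. v \<in> A \<or> card (E `` {v}) \<noteq> 2}"
  have fin_nbrs: "finite (E `` {v})" for v
    using fin sub by (auto intro!: finite_subset[of "E `` {v}" V])
  have card_E_sum: "card E = (\<Sum>v\<in>V. card (E `` {v}))"
    using card_Int_Times_eq_sum[OF fin fin sub] sub by (simp add: Int_absorb2)
  \<comment> \<open>Stated for supersets \<open>T\<close> because \<open>S\<close> itself may be
    empty.\<close>
  have bound: "int (card V) \<le> (s - 1) * (int (card T) + t) + 1"
    if T: "S \<subseteq> T" "T \<subseteq> V" "T \<noteq> {}" for T
  proof -
    interpret branched_graph V E T
      by unfold_locales (use assms T in \<open>auto simp: S_def\<close>)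
    show ?thesis
    proof (rule card_vertices_le[OF \<open>s \<ge> 2\<close> card_E short])
      fix P assume P: "set P \<subseteq> V" "set (butlast (tl P)) \<inter> T = {}"
      have "set (butlast (tl P)) \<subseteq> set P"
        by (metis in_set_butlastD list.set_sel(2) subsetI tl_Nil)
      with P T show "\<forall>v\<in>set (butlast (tl P)). v \<notin> A \<and> card (E `` {v}) = 2"
        by (fastforce simp: S_def)
    qed
  qed
  obtain r where r: "r \<in> V" using \<open>card V \<ge> 2\<close> by fastforce
  show ?thesis
  proof (cases "S = {}")
    case True \<comment> \<open>The graph is a cycle; cutting it at an arbitrary vertex \<open>r\<close> yields one closed ear.\<close>
    then have "A = {}" "card E = 2 * card V"
      using \<open>A \<subseteq> V\<close> card_E_sum by (auto simp: S_def)
    \<comment> \<open>Here t = 0, so the bound for \<open>{r}\<close> reads |V| <= s, contradicting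
      \<open>unmarked\<close>.\<close>
    then show ?thesis using bound[of "{r}"] True r unmarked card_E by simp
  next
    case False
    have pos: "card (E `` {v}) \<ge> 1" if "v \<in> V" for v
    proof -
      obtain u where u: "u \<in> V" "u \<noteq> v"
        using \<open>card V \<ge> 2\<close> by (metis card_2_iff' obtain_subset_with_card_n subsetD)
      from conn[OF that u(1)] u(2) obtain w where "(v, w) \<in> E"
        by (metis converse_rtranclE)
      then show ?thesis using fin_nbrs[of v] by (auto simp: Suc_le_eq card_gt_0_iff)
    qed
    have SV: "S \<subseteq> V" "A \<subseteq> S" using \<open>A \<subseteq> V\<close> by (auto simp: S_def)
    have finS: "finite S" "finite A" using SV fin by (auto dest: finite_subset)
    have cards: "int (card V) = int (card S) + int (card (V - S))"
        "int (card S) = int (card A) + int (card (S - A))"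
      using SV finS fin by (simp_all add: card_Diff_subset card_mono)
    have "(\<Sum>v\<in>S - A. 3) \<le> (\<Sum>v\<in>S - A. card (E `` {v}))"
    proof (rule sum_mono)
      fix v assume v: "v \<in> S - A"
      then show "3 \<le> card (E `` {v})" using leaf[of v] pos[of v] by (auto simp: S_def)
    qed
    moreover have "(\<Sum>v\<in>A. 1) \<le> (\<Sum>v\<in>A. card (E `` {v}))"
      using pos \<open>A \<subseteq> V\<close> by (intro sum_mono) auto
    moreover have "(\<Sum>v\<in>V - S. card (E `` {v})) = 2 * card (V - S)"
      by (simp add: S_def)
    moreover have "card E = (\<Sum>v\<in>V - S. card (E `` {v})) + ((\<Sum>v\<in>S - A. card (E `` {v}))
        + (\<Sum>v\<in>A. card (E `` {v})))"
      using SV finS fin by (simp add: card_E_sum sum.subset_diff[of S V] sum.subset_diff[of A S])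
    ultimately have "2 * card (V - S) + 3 * card (S - A) + card A \<le> card E"
      by simp
    moreover have "int (card E) = 2 * int (card V) + 2 * t" using card_E by simp
    \<comment> \<open>Substituting |E| = 2|V| + 2t into the degree count gives |S - A| <= |A| + 2t,
      that is, |S| <= 2|A| + 2t.\<close>
    ultimately have "int (card S) + t \<le> 2 * int (card A) + 3 * t"
      using cards by linarith
    then have "(s - 1) * (int (card S) + t) \<le> (s - 1) * (2 * int (card A) + 3 * t)"
      using \<open>s \<ge> 2\<close> by (intro mult_left_mono) auto
    then show ?thesis using bound[of S] SV False by simp
  qed
qed

text \<open>The clause for \<open>w \<in> L\<close> serves as the invariant for walks that pass through a leaf.\<close>

lemma prune_leaves_connected:
  assumes "sym E" "E \<subseteq> V \<times> V"
    and leaf: "\<And>l. l \<in> L \<Longrightarrow> card (E `` {l}) = 1"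
    and "(u, w) \<in> E\<^sup>*" "u \<in> V - L"
  shows "if w \<in> L then \<forall>z. (w, z) \<in> E \<longrightarrow> z \<in> V - L \<and> (u, z) \<in> (E \<inter> (V - L) \<times> (V - L))\<^sup>*
    else (u, w) \<in> (E \<inter> (V - L) \<times> (V - L))\<^sup>*"
  using assms(4)
proof (induction)
  case base
  then show ?case using assms(5) by auto
next
  case (step y w)
  have wy: "(w, y) \<in> E" using step \<open>sym E\<close> by (auto dest: symD)
  show ?case
  proof (cases "y \<in> L")
    case True
    then have "w \<in> V - L" "(u, w) \<in> (E \<inter> (V - L) \<times> (V - L))\<^sup>*"
      using step by auto
    then show ?thesis by simp
  next
    case False
    then have y: "y \<in> V - L" "(u, y) \<in> (E \<inter> (V - L) \<times> (V - L))\<^sup>*"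
      using step assms(2) by auto
    show ?thesis
    proof (cases "w \<in> L")
      case True
      then have "z = y" if "(w, z) \<in> E" for z
        using leaf[OF True] wy that by (metis Image_singleton_iff card_1_singletonE singletonD)
      then show ?thesis using y True by auto
    next
      case False
      then have "(y, w) \<in> E \<inter> (V - L) \<times> (V - L)" using step y assms(2) by auto
      then show ?thesis using y False by (auto intro: rtrancl_into_rtrancl)
    qed
  qed
qed

text \<open>Each deleted leaf takes exactly one edge with it, so \<open>t\<close> is unchanged and
  the bound for marked graphs applies to the rest. A remainder with a single vertex gives the term n
  - 1.\<close>

lemma card_leaves_ge:
  fixes V :: "'a set" and s t :: int
  assumes fin: "finite V" and sub: "E \<subseteq> V \<times> V" and "sym E" and "irrefl E"
    and conn: "\<And>u v. u \<in> V \<Longrightarrow> v \<in> V \<Longrightarrow> (u, v) \<in> E\<^sup>*"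
    and "s \<ge> 2" and "int (card V) \<ge> s + 1"
    and card_E: "int (card E) = 2 * (int (card V) + t)"
    and short: "\<And>P. P \<noteq> [] \<Longrightarrow> distinct P \<Longrightarrow> set P \<subseteq> V
      \<Longrightarrow> successively (\<lambda>u v. (u, v) \<in> E) P
      \<Longrightarrow> (\<forall>v\<in>set (butlast (tl P)). card (E `` {v}) = 2) \<Longrightarrow> int (length P) \<le> s"
  defines "L \<equiv> {v \<in> V. card (E `` {v}) = 1}"
  defines "A \<equiv> E `` L"
  shows "int (card L) \<ge> min (int (card V) - 1)
      (int (card V) - (s - 1) * (2 * int (card A) + 3 * t) - 1)"
    and "card A \<le> card L"
proof -
  define W where "W = V - L"
  define F where "F = E \<inter> W \<times> W"
  have L: "L \<subseteq> V" "finite L" using fin by (auto simp: L_def)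
  have fin_E: "finite E" using fin sub finite_subset by blast
  have deg_L: "card (E `` {l}) = 1" if "l \<in> L" for l using that by (simp add: L_def)
  have "card A \<le> card (E \<inter> L \<times> V)"
  proof -
    have "A = snd ` (E \<inter> L \<times> V)" using sub by (force simp: A_def)
    then show ?thesis using fin_E by (simp add: card_image_le)
  qed
  moreover have card_EL: "card (E \<inter> L \<times> V) = card L"
    using card_Int_Times_eq_sum[OF L(2) fin sub] deg_L by simp
  ultimately show "card A \<le> card L" by simp
  \<comment> \<open>If all vertices were leaves, a vertex and its neighbour would form the whole
    graph, but there are at least s + 1 >= 3 vertices.\<close>
  have "W \<noteq> {}"
  proof
    assume "W = {}"
    then have VL: "V \<subseteq> L" by (auto simp: W_def)
    obtain u where u: "u \<in> V" using assms(6,7) by fastforce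
    then obtain w where w: "E `` {u} = {w}"
      using deg_L VL by (metis card_1_singletonE subsetD)
    then have "(u, w) \<in> E" by blast
    then have "w \<in> V" "(w, u) \<in> E" using sub \<open>sym E\<close> by (auto dest: symD)
    then have "E `` {w} = {u}"
      using deg_L[of w] VL by (metis Image_singleton_iff card_1_singletonE singletonD subsetD)
    with w have "E `` {u, w} \<subseteq> {u, w}" using Image_Un[of E "{u}" "{w}"] by auto
    then have "E\<^sup>* `` {u, w} = {u, w}" by (rule Image_closed_trancl)
    then have "V \<subseteq> {u, w}" using conn[OF u] by blast
    then have "card V \<le> card {u, w}" by (intro card_mono) auto
    then show False using assms(6,7) by (simp add: card_insert_if split: if_splits)
  qed
  then obtain r where r: "r \<in> V - L" by (auto simp: W_def)
  have prune: "if w \<in> L then \<forall>z. (w, z) \<in> E \<longrightarrow> z \<in> W \<and> (u, z) \<in> F\<^sup>* else (u, w) \<in> F\<^sup>*"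
    if "(u, w) \<in> E\<^sup>*" "u \<in> W" for u w
    unfolding F_def W_def
    by (rule prune_leaves_connected[OF \<open>sym E\<close> sub deg_L])
      (use that in \<open>simp_all add: W_def\<close>)
  \<comment> \<open>By connectivity from the non-leaf \<open>r\<close>, the pruning invariant
    excludes adjacent leaves.\<close>
  have no_leaf_pair: "z \<in> W" if "l \<in> L" "(l, z) \<in> E" for l z
    using prune[of r l] conn[of r l] that r L by (auto simp: W_def)
  have A_sub: "A \<subseteq> W" using no_leaf_pair by (auto simp: A_def)
  have cardV: "int (card V) = int (card W) + int (card L)"
    using L fin by (simp add: W_def card_Diff_subset card_mono)
  show "int (card L) \<ge> min (int (card V) - 1)
      (int (card V) - (s - 1) * (2 * int (card A) + 3 * t) - 1)"
  proof (cases "card W \<ge> 2")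
    case False
    then show ?thesis using cardV by linarith
  next
    case True
    \<comment> \<open>The arcs split into those inside \<open>W\<close>, those leaving leaves, and
      the reverses of the latter; these are disjoint since no two leaves are adjacent.\<close>
    have "card E = card F + 2 * card L"
    proof -
      have "E = F \<union> (E \<inter> L \<times> V \<union> (E \<inter> L \<times> V)\<inverse>)"
        using sub \<open>sym E\<close> by (auto simp: F_def W_def dest: symD)
      moreover have "card (F \<union> (E \<inter> L \<times> V \<union> (E \<inter> L \<times> V)\<inverse>))
          = card F + card (E \<inter> L \<times> V \<union> (E \<inter> L \<times> V)\<inverse>)"
        using fin_E by (intro card_Un_disjoint) (auto simp: F_def W_def)
      moreover have "card (E \<inter> L \<times> V \<union> (E \<inter> L \<times> V)\<inverse>)
          = card (E \<inter> L \<times> V) + card ((E \<inter> L \<times> V)\<inverse>)"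
        using fin_E no_leaf_pair by (intro card_Un_disjoint) (auto simp: W_def)
      ultimately show ?thesis using card_EL by simp
    qed
    then have card_F: "int (card F) = 2 * (int (card W) + t)" using card_E cardV by simp
    have deg_F: "F `` {v} = E `` {v}" if "v \<in> W - A" for v
      using that sub \<open>sym E\<close> by (auto simp: F_def W_def A_def dest: symD)
    have "int (card W) \<le> (s - 1) * (2 * int (card A) + 3 * t) + 1"
    proof (rule marked_graph_card_le[where E = F])
      show "finite W" using fin by (simp add: W_def)
      show "F \<subseteq> W \<times> W" "sym F" "irrefl F"
        using \<open>sym E\<close> \<open>irrefl E\<close> by (auto simp: F_def sym_def irrefl_def)
      show "(u, v) \<in> F\<^sup>*" if "u \<in> W" "v \<in> W" for u v
        using prune[of u v] conn[of u v] that by (auto simp: W_def)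
      show "card (F `` {v}) \<noteq> 1" if "v \<in> W - A" for v
        using deg_F[OF that] that by (auto simp: W_def L_def)
      show "int (card W) > s" if "A = {}"
      proof -
        \<comment> \<open>With \<open>A\<close> empty there are no leaves, so \<open>W\<close> is
          all of \<open>V\<close>.\<close>
        have "E `` {l} = {}" if "l \<in> L" for l using \<open>A = {}\<close> that by (auto simp: A_def)
        then have "L = {}" using deg_L by fastforce
        then show ?thesis using assms(7) by (simp add: W_def)
      qed
      fix P assume P: "P \<noteq> []" "distinct P" "set P \<subseteq> W" "successively (\<lambda>u v. (u, v) \<in> F) P"
        "\<forall>v\<in>set (butlast (tl P)). v \<notin> A \<and> card (F `` {v}) = 2"
      have "set (butlast (tl P)) \<subseteq> set P"
        by (metis in_set_butlastD list.set_sel(2) subsetI tl_Nil)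
      then have "\<forall>v\<in>set (butlast (tl P)). card (E `` {v}) = 2"
        using P deg_F by (metis DiffI subsetD)
      moreover have "successively (\<lambda>u v. (u, v) \<in> E) P"
        using P(4) by (rule successively_mono) (auto simp: F_def)
      ultimately show "int (length P) \<le> s" using P by (intro short) (auto simp: W_def)
    qed (use True A_sub card_F \<open>s \<ge> 2\<close> in auto)
    then show ?thesis using cardV by linarith
  qed
qed

section \<open>Transfer to graphs\<close>

context graph
begin

text \<open>Without parallel arcs, an outgoing arc is determined by its head.\<close>

lemma out_degree_eq_card_Image: "out_degree G v = card (arcs_ends G `` {v})"
proof -
  have "arcs_ends G `` {v} = head G ` out_arcs G v"
    by (auto simp: arcs_ends_conv out_arcs_def)
  moreover have "inj_on (head G) (out_arcs G v)"
    using no_multi_arcs by (auto simp: inj_on_def out_arcs_def arc_to_ends_def)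
  ultimately show ?thesis by (simp add: out_degree_def card_image)
qed

lemma card_arcs_ends: "card (arcs_ends G) = 2 * card (uedges G)"
proof -
  have "uedges G = (\<lambda>(u, v). {u, v}) ` arcs_ends G" by (auto simp: uedges_def)
  moreover have "finite (arcs_ends G)" by (simp add: arcs_ends_def)
  moreover have "sym (arcs_ends G)" using sym_arcs by (simp add: symmetric_def)
  moreover have "irrefl (arcs_ends G)" using no_loops by (auto simp: arcs_ends_conv irrefl_def)
  ultimately show ?thesis by (simp add: card_sym_irrefl)
qed

end

theorem lemma2p6:
  fixes G :: "('a, 'b) pre_digraph" and s n t p :: int
  assumes "s \<ge> 2" and "n \<ge> s + 1" and "t \<ge> -1"
    and "graph G" and "Digraph_Component.connected G"
    and "int (card (verts G)) = n"
    and "int (card (uedges G)) = n + t"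
    and "\<not> (\<exists>P. suspended_path G P \<and> int (length P) > s)"
    and "p = int (card (leaf_neighbours G))"
  shows "int (card (leaves G)) \<ge> min (n - 1) (n - (s - 1) * (2 * p + 3 * t) - 1)
    \<and> real (card (leaves G)) \<ge> real_of_int (n - 3 * (s - 1) * t - 1) / real_of_int (2 * s - 1)"
proof -
  interpret graph G by fact
  let ?V = "verts G" and ?E = "arcs_ends G"
  have sub: "?E \<subseteq> ?V \<times> ?V" by (auto simp: arcs_ends_conv)
  have sym: "sym ?E" using sym_arcs by (simp add: symmetric_def)
  have irr: "irrefl ?E" using no_loops by (auto simp: arcs_ends_conv irrefl_def)
  have conn: "(u, v) \<in> ?E\<^sup>*" if "u \<in> ?V" "v \<in> ?V" for u v
  proof -
    \<comment> \<open>Connectedness refers to the symmetric closure, which has the same reachability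
      here because the arcs are already symmetric.\<close>
    have "u \<rightarrow>\<^sup>*\<^bsub>G\<^esub> v"
      using assms(5) that reachable_mk_symmetric_eq[OF sym_arcs]
      by (auto simp: Digraph_Component.connected_def strongly_connected_def)
    then show ?thesis unfolding reachable_def by (rule rtrancl_on_rtranclI)
  qed
  have L: "leaves G = {v \<in> ?V. card (?E `` {v}) = 1}"
    by (simp add: leaves_def out_degree_eq_card_Image)
  have A: "leaf_neighbours G = ?E `` leaves G"
    using sub sym by (auto simp: leaf_neighbours_def dest: symD)
  have short: "int (length P) \<le> s"
    if "P \<noteq> []" "distinct P" "set P \<subseteq> ?V" "successively (\<lambda>u v. (u, v) \<in> ?E) P"
      "\<forall>v\<in>set (butlast (tl P)). card (?E `` {v}) = 2" for P
  proof -
    have "suspended_path G P"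
      using that by (auto simp: suspended_path_def vpath_def vwalk_def vwalk_arcs_subset_iff
          out_degree_eq_card_Image)
    then show ?thesis using assms(8) by force
  qed
  have card_E: "int (card ?E) = 2 * (int (card ?V) + t)"
    using assms(6,7) by (simp add: card_arcs_ends)
  have card_V: "int (card ?V) \<ge> s + 1" using assms(2,6) by simp
  have bounds: "int (card (leaves G)) \<ge> min (int (card ?V) - 1)
      (int (card ?V) - (s - 1) * (2 * int (card (leaf_neighbours G)) + 3 * t) - 1)"
    "card (leaf_neighbours G) \<le> card (leaves G)"
    unfolding A L
    by (rule card_leaves_ge[OF finite_verts sub sym irr conn assms(1) card_V card_E short];
        assumption)+
  have main: "int (card (leaves G)) \<ge> min (n - 1) (n - (s - 1) * (2 * p + 3 * t) - 1)"
    using bounds(1) by (simp only: assms(6,9))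
  have p: "p \<le> int (card (leaves G))" using bounds(2) by (simp add: assms(9))
  let ?l = "int (card (leaves G))"
  have "n - 3 * (s - 1) * t - 1 \<le> ?l * (2 * s - 1)"
  proof (cases "?l \<ge> n - 1")
    case True
    \<comment> \<open>It remains to see that -3(s-1)t <= (2s-2)(n-1). As t >= -1 and n - 1 >= s >=
      2, the left side is at most 3(s-1) and the right side at least 4(s-1).\<close>
    have "(s - 1) * (- t) \<le> (s - 1) * 1" using assms by (intro mult_left_mono) auto
    moreover have "(2 * s - 2) * 2 \<le> (2 * s - 2) * (n - 1)"
      using assms by (intro mult_left_mono) auto
    moreover have "(n - 1) * (2 * s - 1) \<le> ?l * (2 * s - 1)"
      using True assms by (intro mult_right_mono) auto
    ultimately show ?thesis using assms(1) by (simp add: algebra_simps)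
  next
    case False
    then have "?l \<ge> n - (s - 1) * (2 * p + 3 * t) - 1" using main by linarith
    \<comment> \<open>Replacing \<open>p\<close> by the number of leaves and collecting terms
      produces the factor 1 + 2(s-1) = 2s - 1.\<close>
    moreover have "(s - 1) * (2 * p) \<le> (s - 1) * (2 * ?l)"
      using assms p by (intro mult_left_mono) auto
    ultimately show ?thesis by (simp add: algebra_simps)
  qed
  then have "real_of_int (n - 3 * (s - 1) * t - 1) \<le> real_of_int (?l * (2 * s - 1))"
    by (simp only: of_int_le_iff)
  then have "real_of_int (n - 3 * (s - 1) * t - 1) / real_of_int (2 * s - 1)
      \<le> real (card (leaves G))"
    using assms(1) by (simp add: divide_le_eq)
  with main show ?thesis by simp
qed

end
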